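(* Let $m,n$ be positive integers, let $\Omega_1,\dots,\Omega_m$ be real skew-symmetric $n\times n$ matrices that are not all equal, let $k>0$, and let $A=(a_{ij})$ be the $m\times m$ weighted adjacency matrix of a weighted digraph. Consider the high-dimensional Kuramoto model with nonidentical oscillators on the unit sphere, $$\dot r_i=\Omega_i r_i+k\sum_{j=1}^m a_{ij}\big(r_j-(r_i^{\mathrm T}r_j)r_i\big),\qquad r_i\in\mathbf{R}^n,\ \|r_i\|=1,\qquad i=1,\dots,m.$$ If there is a solution $r(t)=(r_1^{\mathrm T}(t),\dots,r_m^{\mathrm T}(t))^{\mathrm T}\in\mathbf{R}^{mn}$ of this system that exhibits complete phase synchronization, then $\dim(W)>0$ (equivalently, $W\neq\{0\}$), where $$W=\bigcap_{l=1}^{n}\{\xi\in\mathbf{R}^n : \Omega_1^l\xi=\Omega_2^l\xi=\cdots=\Omega_m^l\xi\}=\bigcap_{l=1}^{n}\bigcap_{i=2}^m\ker(\Omega_i^l-\Omega_1^l).$$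
   Context: The weighted adjacency matrix $A=(a_{ij})$ of a weighted digraph on vertices $\{1,\dots,m\}$ with edge set $\mathcal{E}$ satisfies $a_{ij}>0$ if $(j,i)\in\mathcal{E}$ and $a_{ij}=0$ otherwise. Each $\|r_i(t)\|$ is constant along solutions, so the unit sphere constraint is preserved by the flow. A solution $r(t)$ is said to exhibit (achieve) complete phase synchronization if $\lim_{t\to+\infty}(r_i(t)-r_j(t))=0$ for all $1\le i,j\le m$. The norm is Euclidean. *)

theory Defs
  imports "HOL-Analysis.Analysis"
begin

text \<open>
  The type \<open>'m\<close> indexes the oscillators (vertices) and \<open>'n\<close> the coordinates, so that
  \<open>m = CARD('m)\<close> and \<open>n = CARD('n)\<close>; a state in \<open>R\<^sup>m\<^sup>n\<close> is an element of \<open>(real^'n)^'m\<close>.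
\<close>

definition skew_symmetric :: "real^'n^'n \<Rightarrow> bool" where
  "skew_symmetric M \<longleftrightarrow> transpose M = - M"

text \<open>The operation \<open>^\<close> on type \<open>real^'n^'n\<close> is the componentwise power, not the matrix power.\<close>

primrec matrix_power :: "real^'n^'n \<Rightarrow> nat \<Rightarrow> real^'n^'n" where
  "matrix_power M 0 = mat 1"
| "matrix_power M (Suc l) = M ** matrix_power M l"

definition weighted_adjacency_matrix :: "('m \<times> 'm) set \<Rightarrow> real^'m^'m \<Rightarrow> bool" where
  "weighted_adjacency_matrix E A \<longleftrightarrow>
     (\<forall>i j. ((j, i) \<in> E \<longrightarrow> A $ i $ j > 0) \<and> ((j, i) \<notin> E \<longrightarrow> A $ i $ j = 0))"

definition kuramoto_field ::
    "('m \<Rightarrow> real^'n^'n) \<Rightarrow> real \<Rightarrow> real^'m^'m \<Rightarrow> (real^'n)^'m \<Rightarrow> 'm \<Rightarrow> real^'n" where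
  "kuramoto_field \<Omega> k A x i =
     \<Omega> i *v (x $ i) +
     k *\<^sub>R (\<Sum>j\<in>UNIV. A $ i $ j *\<^sub>R (x $ j - (x $ i \<bullet> x $ j) *\<^sub>R (x $ i)))"

text \<open>Solutions are considered on \<open>[0, \<infinity>)\<close>, with a one-sided derivative at \<open>0\<close>.\<close>

definition kuramoto_solution ::
    "('m \<Rightarrow> real^'n^'n) \<Rightarrow> real \<Rightarrow> real^'m^'m \<Rightarrow> (real \<Rightarrow> (real^'n)^'m) \<Rightarrow> bool" where
  "kuramoto_solution \<Omega> k A r \<longleftrightarrow>
     (\<forall>t\<ge>0. \<forall>i. norm (r t $ i) = 1 \<and>
        ((\<lambda>s. r s $ i) has_vector_derivative kuramoto_field \<Omega> k A (r t) i) (at t within {0..}))"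

definition complete_phase_synchronization :: "(real \<Rightarrow> (real^'n)^'m) \<Rightarrow> bool" where
  "complete_phase_synchronization r \<longleftrightarrow>
     (\<forall>i j. ((\<lambda>t. r t $ i - r t $ j) \<longlongrightarrow> 0) at_top)"

definition sync_space :: "('m \<Rightarrow> real^'n^'n) \<Rightarrow> (real^'n) set" where
  "sync_space \<Omega> =
     (\<Inter>l\<in>{1..CARD('n)}.
        {\<xi>. \<forall>i j. matrix_power (\<Omega> i) l *v \<xi> = matrix_power (\<Omega> j) l *v \<xi>})"

lemma sync_space_eq_kernels:
  "sync_space \<Omega> =
     (\<Inter>l\<in>{1..CARD('n)}. \<Inter>i\<in>- {i0}.
        {\<xi>. (matrix_power (\<Omega> i) l - matrix_power (\<Omega> i0) l) *v \<xi> = 0})"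
  for \<Omega> :: "'m \<Rightarrow> real^'n^'n"
proof -
  have "{\<xi>. \<forall>i j. matrix_power (\<Omega> i) l *v \<xi> = matrix_power (\<Omega> j) l *v \<xi>} =
      (\<Inter>i\<in>- {i0}. {\<xi>. (matrix_power (\<Omega> i) l - matrix_power (\<Omega> i0) l) *v \<xi> = 0})" for l
  proof (intro equalityI subsetI INT_I CollectI allI)
    fix \<xi> i
    assume "\<xi> \<in> {\<xi>. \<forall>i j. matrix_power (\<Omega> i) l *v \<xi> = matrix_power (\<Omega> j) l *v \<xi>}"
    then have "matrix_power (\<Omega> i) l *v \<xi> = matrix_power (\<Omega> i0) l *v \<xi>"
      by blast
    then show "(matrix_power (\<Omega> i) l - matrix_power (\<Omega> i0) l) *v \<xi> = 0"
      by (simp only: matrix_vector_mult_diff_rdistrib diff_self)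
  next
    fix \<xi> i j
    assume *: "\<xi> \<in> (\<Inter>i\<in>- {i0}. {\<xi>. (matrix_power (\<Omega> i) l - matrix_power (\<Omega> i0) l) *v \<xi> = 0})"
    have eq: "matrix_power (\<Omega> i) l *v \<xi> = matrix_power (\<Omega> i0) l *v \<xi>" for i
    proof (cases "i = i0")
      case False
      with * have "(matrix_power (\<Omega> i) l - matrix_power (\<Omega> i0) l) *v \<xi> = 0"
        by blast
      then show ?thesis
        by (simp only: matrix_vector_mult_diff_rdistrib right_minus_eq)
    qed simp
    show "matrix_power (\<Omega> i) l *v \<xi> = matrix_power (\<Omega> j) l *v \<xi>"
      by (rule trans[OF eq sym[OF eq]])
  qed
  then show ?thesis
    by (simp only: sync_space_def)
qed

lemma subspace_sync_space: "subspace (sync_space \<Omega>)"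
proof -
  have kernel: "subspace {\<xi>. (matrix_power (\<Omega> i) l - matrix_power (\<Omega> i0) l) *v \<xi> = 0}" for l i i0
    by (rule linear_subspace_kernel) (rule matrix_vector_mul_linear)
  have INT: "subspace (\<Inter>x\<in>X. S x)" if "\<And>x. subspace (S x)"
    for X :: "'x set" and S :: "'x \<Rightarrow> (real^'k::finite) set"
    using that by (blast intro: subspace_Inter)
  show ?thesis
    unfolding sync_space_eq_kernels[where ?i0.0 = undefined]
    by (rule INT, rule INT, rule kernel)
qed

lemma dim_sync_space_pos_iff: "dim (sync_space \<Omega>) > 0 \<longleftrightarrow> sync_space \<Omega> \<noteq> {0}"
proof -
  have "0 \<in> sync_space \<Omega>"
    by (rule subspace_0[OF subspace_sync_space])
  then have "sync_space \<Omega> \<subseteq> {0} \<longleftrightarrow> sync_space \<Omega> = {0}"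
    by blast
  then show ?thesis
    unfolding neq0_conv[symmetric] dim_eq_0 by (rule arg_cong)
qed

end

theory Submission
  imports Defs
begin

text \<open>
  Under synchronization the coupling terms vanish asymptotically, so every \<open>r\<^sub>i\<close> satisfies
  \<open>r\<^sub>i' = \<Omega>\<^sub>i r\<^sub>i + o(1)\<close>. A form of Barbalat's lemma applied to \<open>r\<^sub>i - r\<^sub>p \<longlongrightarrow> 0\<close> gives
  \<open>(\<Omega>\<^sub>i - \<Omega>\<^sub>p) r\<^sub>p \<longlongrightarrow> 0\<close>, and applying it repeatedly yields
  \<open>(\<Omega>\<^sub>i - \<Omega>\<^sub>p) \<Omega>\<^sub>p\<^sup>l r\<^sub>p \<longlongrightarrow> 0\<close> for all \<open>l\<close>. Any limit point of \<open>r\<^sub>p\<close> is a unit vector annihilated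
  by all \<open>(\<Omega>\<^sub>i - \<Omega>\<^sub>p) \<Omega>\<^sub>p\<^sup>l\<close>, hence a nonzero vector of the synchronization space.
\<close>

text \<open>This map is the Frechet derivative of a curve with velocity \<open>a\<close>; the mean
  value inequalities below ask for a bound on its operator norm.\<close>

lemma onorm_scaleR_right_le:
  fixes a :: "'a::real_normed_vector"
  assumes "norm a \<le> b"
  shows "onorm (\<lambda>v. v *\<^sub>R a) \<le> b"
proof (rule onorm_le)
  show "norm (v *\<^sub>R a) \<le> b * norm v" for v
    using mult_left_mono[OF assms abs_ge_zero[of v]] by (simp add: mult.commute)
qed

text \<open>On a short interval of fixed length \<open>d\<close> after \<open>t\<close>, Lipschitz
  continuity keeps \<open>g\<close> near \<open>g t\<close>, so \<open>f\<close> moves by about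
  \<open>d *\<^sub>R g t\<close>. Since \<open>f\<close> itself tends to 0, \<open>g t\<close> must
  be small. Regularity is placed on \<open>g\<close> alone, so \<open>h\<close> can absorb errors
  known only to vanish.\<close>

lemma barbalat_perturbed:
  fixes f g h :: "real \<Rightarrow> 'a::real_normed_vector"
  assumes deriv: "\<And>t. t \<ge> 0 \<Longrightarrow> (f has_vector_derivative g t + h t) (at t within {0..})"
    and lim_f: "(f \<longlongrightarrow> 0) at_top"
    and lim_h: "(h \<longlongrightarrow> 0) at_top"
    and lipschitz: "L-lipschitz_on {0..} g"
  shows "(g \<longlongrightarrow> 0) at_top"
proof (rule tendstoI)
  fix e :: real
  assume "e > 0"
  \<comment> \<open>The estimate ends at \<open>4 * c\<close>: one \<open>c\<close> from each
    endpoint value of \<open>f\<close>, and \<open>2 * c\<close> from the variation of the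
    derivative.\<close>
  define c where "c = e / 5"
  have "c > 0"
    using \<open>e > 0\<close> by (simp add: c_def)
  have "L \<ge> 0"
    using lipschitz by (rule lipschitz_on_nonneg)
  \<comment> \<open>Using \<open>L + 1\<close> keeps the denominator positive when
    \<open>L = 0\<close> and still gives \<open>L * d \<le> c\<close>.\<close>
  define d where "d = c / (L + 1)"
  have "d > 0"
    using \<open>c > 0\<close> \<open>L \<ge> 0\<close> by (simp add: d_def)
  have "d * (L + 1) = c"
    using \<open>L \<ge> 0\<close> by (simp add: d_def)
  with \<open>d > 0\<close> have Ld: "L * d \<le> c"
    by (simp add: algebra_simps)
  have "\<forall>\<^sub>F t in at_top. norm (f t) < c * d" "\<forall>\<^sub>F t in at_top. norm (h t) < c"
    using tendstoD[OF lim_f, of "c * d"] tendstoD[OF lim_h, of c] \<open>c > 0\<close> \<open>d > 0\<close>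
    by simp_all
  then have "\<forall>\<^sub>F t in at_top. t \<ge> 0 \<and> norm (f t) < c * d \<and> norm (h t) < c"
    using eventually_ge_at_top[of "0::real"] by eventually_elim simp
  then obtain T where T: "\<And>t. t \<ge> T \<Longrightarrow> t \<ge> 0 \<and> norm (f t) < c * d \<and> norm (h t) < c"
    unfolding eventually_at_top_linorder by blast
  have "norm (g t) < e" if "t \<ge> T" for t
  proof -
    have nonneg: "t \<ge> 0"
      using T that by blast
    have sub: "{t..t + d} \<subseteq> {0..}"
      using nonneg by auto
    \<comment> \<open>Mean value inequality for \<open>f\<close> minus the linear motion with
      velocity \<open>g t\<close>: the derivative of the difference is
      \<open>(g s - g t) + h s\<close>, and each summand has norm at most \<open>c\<close>.\<close>
    have "norm ((f (t + d) - (t + d) *\<^sub>R g t) - (f t - t *\<^sub>R g t)) \<le> norm ((t + d) - t) * (2 * c)"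
    proof (rule differentiable_bound[of "{t..t + d}" "\<lambda>s. f s - s *\<^sub>R g t"
          "\<lambda>s v. v *\<^sub>R (g s + h s - g t)", THEN order_trans])
      show "((\<lambda>s. f s - s *\<^sub>R g t) has_derivative (\<lambda>v. v *\<^sub>R (g s + h s - g t)))
          (at s within {t..t + d})" if "s \<in> {t..t + d}" for s
      proof -
        have "(f has_vector_derivative g s + h s) (at s within {t..t + d})"
          using deriv[of s] that sub has_vector_derivative_within_subset by fastforce
        moreover have "((\<lambda>s. s *\<^sub>R g t) has_vector_derivative g t) (at s within {t..t + d})"
          by (auto intro!: derivative_eq_intros simp: has_vector_derivative_def)
        ultimately show ?thesis
          unfolding has_vector_derivative_def[symmetric] by (rule has_vector_derivative_diff)
      qed
      show "onorm (\<lambda>v. v *\<^sub>R (g s + h s - g t)) \<le> 2 * c" if s: "s \<in> {t..t + d}" for s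
      proof (rule onorm_scaleR_right_le)
        have "norm (g s - g t) \<le> L * \<bar>s - t\<bar>"
          using lipschitz_onD[OF lipschitz, of s t] s nonneg by (simp add: dist_norm)
        also have "\<dots> \<le> L * d"
          using s \<open>L \<ge> 0\<close> by (intro mult_left_mono) auto
        finally have "norm (g s - g t) \<le> c"
          using Ld by simp
        moreover have "norm (h s) < c"
          using T s that \<open>t \<ge> T\<close> by simp
        ultimately have "norm ((g s - g t) + h s) \<le> 2 * c"
          using norm_triangle_ineq[of "g s - g t" "h s"] by linarith
        then show "norm (g s + h s - g t) \<le> 2 * c"
          by (simp add: algebra_simps)
      qed
    qed (use \<open>d > 0\<close> in auto)
    then have bound: "norm (f (t + d) - f t - d *\<^sub>R g t) \<le> d * (2 * c)"
      using \<open>d > 0\<close> by (simp add: algebra_simps)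
    have "d * norm (g t) = norm ((f (t + d) - f t) - (f (t + d) - f t - d *\<^sub>R g t))"
      using \<open>d > 0\<close> by simp
    also have "\<dots> \<le> norm (f (t + d)) + norm (f t) + d * (2 * c)"
      using norm_triangle_ineq4[of "f (t + d) - f t" "f (t + d) - f t - d *\<^sub>R g t"]
        norm_triangle_ineq4[of "f (t + d)" "f t"] bound by linarith
    also have "\<dots> < d * (4 * c)"
      using T[of "t + d"] T[of t] that \<open>d > 0\<close> by (simp add: algebra_simps)
    finally have "norm (g t) < 4 * c"
      using \<open>d > 0\<close> by simp
    then show ?thesis
      using \<open>e > 0\<close> by (simp add: c_def)
  qed
  then show "\<forall>\<^sub>F t in at_top. dist (g t) 0 < e"
    unfolding eventually_at_top_linorder dist_0_norm by (auto simp: dist_norm)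
qed

lemma matrix_power_commute: "matrix_power M l ** M = M ** matrix_power M l"
  by (induction l) (simp_all add: matrix_mul_assoc[symmetric])

lemma tendsto_matrix_vector_mult:
  fixes B :: "real^'n^'k"
  assumes "(x \<longlongrightarrow> v) F"
  shows "((\<lambda>t. B *v x t) \<longlongrightarrow> B *v v) F"
  by (rule bounded_linear.tendsto[OF matrix_vector_mul_bounded_linear assms])

lemma lipschitz_on_matrix_vector_mult:
  fixes B :: "real^'n^'k" and x :: "real \<Rightarrow> real^'n"
  assumes "L-lipschitz_on S x"
  shows "\<exists>C. C-lipschitz_on S (\<lambda>t. B *v x t)"
proof -
  obtain C where "C-lipschitz_on (x ` S) ((*v) B)"
    using bounded_linear.lipschitz_boundE[OF matrix_vector_mul_bounded_linear] by blast
  then have "(C * L)-lipschitz_on S (\<lambda>t. B *v x t)"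
    by (rule lipschitz_on_compose2[OF assms])
  then show ?thesis ..
qed

text \<open>Differentiating \<open>B M^l x\<close> gives \<open>B M^(l+1) x\<close> plus a vanishing
  error, so each use of the perturbed Barbalat lemma raises the power by one.\<close>

lemma annihilated_along_powers:
  fixes x e :: "real \<Rightarrow> real^'n" and B :: "real^'n^'k"
  assumes deriv: "\<And>t. t \<ge> 0 \<Longrightarrow> (x has_vector_derivative M *v x t + e t) (at t within {0..})"
    and lim_e: "(e \<longlongrightarrow> 0) at_top"
    and lipschitz: "L-lipschitz_on {0..} x"
    and lim: "((\<lambda>t. B *v x t) \<longlongrightarrow> 0) at_top"
  shows "((\<lambda>t. (B ** matrix_power M l) *v x t) \<longlongrightarrow> 0) at_top"
proof (induction l)
  case 0
  then show ?case
    using lim by simp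
next
  case (Suc l)
  let ?B = "B ** matrix_power M l"
  obtain C where C: "C-lipschitz_on {0..} (\<lambda>t. (?B ** M) *v x t)"
    using lipschitz_on_matrix_vector_mult[OF lipschitz] by blast
  have "((\<lambda>t. (?B ** M) *v x t) \<longlongrightarrow> 0) at_top"
  proof (rule barbalat_perturbed[OF _ Suc _ C])
    show "((\<lambda>t. ?B *v x t) has_vector_derivative (?B ** M) *v x t + ?B *v e t) (at t within {0..})"
      if "t \<ge> 0" for t
      using bounded_linear.has_vector_derivative[OF matrix_vector_mul_bounded_linear deriv[OF that],
          of ?B]
      by (simp add: matrix_vector_right_distrib matrix_vector_mul_assoc)
    show "((\<lambda>t. ?B *v e t) \<longlongrightarrow> 0) at_top"
      using tendsto_matrix_vector_mult[OF lim_e, of ?B] by simp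
  qed
  \<comment> \<open>The new factor \<open>M\<close> arises on the right, whereas
    \<open>matrix_power\<close> multiplies on the left; the two agree because powers of
    \<open>M\<close> commute with \<open>M\<close>.\<close>
  then show ?case
    by (simp add: matrix_mul_assoc[symmetric] matrix_power_commute)
qed

text \<open>The interaction part of \<open>kuramoto_field\<close>, isolated because it is the
  perturbation that dies out under synchronization.\<close>

definition coupling :: "real \<Rightarrow> real^'m^'m \<Rightarrow> (real^'n)^'m \<Rightarrow> 'm \<Rightarrow> real^'n" where
  "coupling k A x i = k *\<^sub>R (\<Sum>j\<in>UNIV. A $ i $ j *\<^sub>R (x $ j - (x $ i \<bullet> x $ j) *\<^sub>R (x $ i)))"

text \<open>Since \<open>x $ i\<close> is a unit vector, each summand can be rewritten in terms of
  the difference \<open>x $ i - x $ j\<close> alone; Cauchy-Schwarz then gives the factor 2.\<close>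

lemma norm_coupling_le:
  fixes x :: "(real^'n)^'m"
  assumes "\<And>j. norm (x $ j) = 1"
  shows "norm (coupling k A x i) \<le> \<bar>k\<bar> * (\<Sum>j\<in>UNIV. \<bar>A $ i $ j\<bar> * (2 * norm (x $ i - x $ j)))"
proof -
  have "norm (x $ j - (x $ i \<bullet> x $ j) *\<^sub>R x $ i) \<le> 2 * norm (x $ i - x $ j)" for j
  proof -
    have "x $ i \<bullet> x $ i = 1"
      using assms by (simp add: norm_eq_1)
    then have "x $ j - (x $ i \<bullet> x $ j) *\<^sub>R x $ i =
        (x $ i \<bullet> (x $ i - x $ j)) *\<^sub>R x $ i - (x $ i - x $ j)"
      by (simp add: algebra_simps)
    also have "norm \<dots> \<le> \<bar>x $ i \<bullet> (x $ i - x $ j)\<bar> + norm (x $ i - x $ j)"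
      using norm_triangle_ineq4[of "(x $ i \<bullet> (x $ i - x $ j)) *\<^sub>R x $ i" "x $ i - x $ j"] assms
      by simp
    also have "\<dots> \<le> 2 * norm (x $ i - x $ j)"
      using Cauchy_Schwarz_ineq2[of "x $ i" "x $ i - x $ j"] assms by simp
    finally show ?thesis .
  qed
  then have "norm (\<Sum>j\<in>UNIV. A $ i $ j *\<^sub>R (x $ j - (x $ i \<bullet> x $ j) *\<^sub>R (x $ i)))
      \<le> (\<Sum>j\<in>UNIV. \<bar>A $ i $ j\<bar> * (2 * norm (x $ i - x $ j)))"
    by (intro sum_norm_le) (simp add: mult_left_mono)
  then show ?thesis
    by (simp add: coupling_def mult_left_mono)
qed

lemma coupling_tendsto_0:
  fixes r :: "real \<Rightarrow> (real^'n)^'m"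
  assumes norm: "\<And>t i. t \<ge> 0 \<Longrightarrow> norm (r t $ i) = 1"
    and sync: "complete_phase_synchronization r"
  shows "((\<lambda>t. coupling k A (r t) i) \<longlongrightarrow> 0) at_top"
proof (rule Lim_null_comparison)
  show "\<forall>\<^sub>F t in at_top. norm (coupling k A (r t) i)
      \<le> \<bar>k\<bar> * (\<Sum>j\<in>UNIV. \<bar>A $ i $ j\<bar> * (2 * norm (r t $ i - r t $ j)))"
    using eventually_ge_at_top[of "0::real"]
    by eventually_elim (rule norm_coupling_le, rule norm)
  have "((\<lambda>t. r t $ i - r t $ j) \<longlongrightarrow> 0) at_top" for j
    using sync by (simp add: complete_phase_synchronization_def)
  then have "((\<lambda>t. norm (r t $ i - r t $ j)) \<longlongrightarrow> 0) at_top" for j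
    by (rule tendsto_norm_zero)
  then show "((\<lambda>t. \<bar>k\<bar> * (\<Sum>j\<in>UNIV. \<bar>A $ i $ j\<bar> * (2 * norm (r t $ i - r t $ j)))) \<longlongrightarrow> 0) at_top"
    by (intro tendsto_mult_right_zero tendsto_null_sum)
qed

text \<open>On the unit sphere distances are at most 2, so the vector field is bounded along the
  solution. This supplies the regularity for the Barbalat argument.\<close>

lemma kuramoto_solution_lipschitz:
  fixes r :: "real \<Rightarrow> (real^'n)^'m"
  assumes "kuramoto_solution \<Omega> k A r"
  shows "\<exists>L. L-lipschitz_on {0..} (\<lambda>t. r t $ i)"
proof -
  have norm: "norm (r t $ i) = 1" if "t \<ge> 0" for t i
    using assms that by (simp add: kuramoto_solution_def)
  define L where "L = onorm ((*v) (\<Omega> i)) + \<bar>k\<bar> * (\<Sum>j\<in>UNIV. \<bar>A $ i $ j\<bar> * (2 * 2))"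
  have bound: "norm (kuramoto_field \<Omega> k A (r t) i) \<le> L" if "t \<ge> 0" for t
  proof -
    have "norm (\<Omega> i *v r t $ i) \<le> onorm ((*v) (\<Omega> i))"
      using onorm[OF matrix_vector_mul_bounded_linear, of "\<Omega> i" "r t $ i"] norm[OF that] by simp
    moreover have "norm (r t $ i - r t $ j) \<le> 2" for j
      using norm_triangle_ineq4[of "r t $ i" "r t $ j"] norm[OF that] by simp
    then have "\<bar>k\<bar> * (\<Sum>j\<in>UNIV. \<bar>A $ i $ j\<bar> * (2 * norm (r t $ i - r t $ j)))
        \<le> \<bar>k\<bar> * (\<Sum>j\<in>UNIV. \<bar>A $ i $ j\<bar> * (2 * 2))"
      by (intro mult_left_mono sum_mono) auto
    then have "norm (coupling k A (r t) i) \<le> \<bar>k\<bar> * (\<Sum>j\<in>UNIV. \<bar>A $ i $ j\<bar> * (2 * 2))"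
      using norm_coupling_le[of "r t" k A i, OF norm[OF that]] by linarith
    ultimately show ?thesis
      unfolding L_def kuramoto_field_def coupling_def
      by (intro order_trans[OF norm_triangle_ineq] add_mono)
  qed
  have "L-lipschitz_on {0..} (\<lambda>t. r t $ i)"
  proof (rule bounded_derivative_imp_lipschitz)
    show "((\<lambda>t. r t $ i) has_derivative (\<lambda>v. v *\<^sub>R kuramoto_field \<Omega> k A (r t) i)) (at t within {0..})"
      if "t \<in> {0..}" for t
      using assms that by (simp add: kuramoto_solution_def has_vector_derivative_def)
    show "onorm (\<lambda>v. v *\<^sub>R kuramoto_field \<Omega> k A (r t) i) \<le> L" if "t \<in> {0..}" for t
      using bound[of t] that by (intro onorm_scaleR_right_le) simp
    show "0 \<le> L"
      using bound[of 0] norm_ge_zero order_trans by blast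
  qed auto
  then show ?thesis ..
qed

text \<open>By induction \<open>N^(l+1) \<xi> = N M^l \<xi>\<close>, and the hypothesis lets the
  leading \<open>N\<close> be replaced by \<open>M\<close>.\<close>

lemma matrix_power_agree:
  fixes M N :: "real^'n^'n"
  assumes "\<And>l. ((N - M) ** matrix_power M l) *v \<xi> = 0"
  shows "matrix_power N l *v \<xi> = matrix_power M l *v \<xi>"
proof (induction l)
  case (Suc l)
  have "matrix_power N (Suc l) *v \<xi> = N *v (matrix_power M l *v \<xi>)"
    using Suc by (simp add: matrix_vector_mul_assoc[symmetric])
  also have "\<dots> = M *v (matrix_power M l *v \<xi>)"
    using assms[of l]
    by (simp add: matrix_vector_mul_assoc[symmetric] matrix_vector_mult_diff_rdistrib)
  finally show ?case
    by (simp add: matrix_vector_mul_assoc)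
qed simp

theorem theorem1:
  fixes \<Omega> :: "'m::finite \<Rightarrow> real^'n^'n"
    and k :: real
    and E :: "('m \<times> 'm) set"
    and A :: "real^'m^'m"
    and r :: "real \<Rightarrow> (real^'n)^'m"
  assumes "\<And>i. skew_symmetric (\<Omega> i)"
    and "\<exists>i j. \<Omega> i \<noteq> \<Omega> j"
    and "k > 0"
    and "weighted_adjacency_matrix E A"
    and "kuramoto_solution \<Omega> k A r"
    and "complete_phase_synchronization r"
  shows "dim (sync_space \<Omega>) > 0"
proof -
  have norm: "norm (r t $ i) = 1" if "t \<ge> 0" for t i
    using assms(5) that by (simp add: kuramoto_solution_def)
  have deriv: "((\<lambda>s. r s $ i) has_vector_derivative \<Omega> i *v r t $ i + coupling k A (r t) i)
      (at t within {0..})" if "t \<ge> 0" for t i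
    using assms(5) that by (simp add: kuramoto_solution_def kuramoto_field_def coupling_def)
  have coupling: "((\<lambda>t. coupling k A (r t) i) \<longlongrightarrow> 0) at_top" for i
    using norm assms(6) by (rule coupling_tendsto_0)
  have sync: "((\<lambda>t. r t $ i - r t $ j) \<longlongrightarrow> 0) at_top" for i j
    using assms(6) by (simp add: complete_phase_synchronization_def)
  \<comment> \<open>An arbitrary reference oscillator; any element of \<open>'m\<close> would
    serve.\<close>
  define p :: 'm where "p = undefined"
  obtain L where L: "L-lipschitz_on {0..} (\<lambda>t. r t $ p)"
    using kuramoto_solution_lipschitz[OF assms(5)] by blast

  have first: "((\<lambda>t. (\<Omega> i - \<Omega> p) *v r t $ p) \<longlongrightarrow> 0) at_top" for i
  proof -
    \<comment> \<open>Writing \<open>\<Omega> i *v r t $ i\<close> as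
      \<open>\<Omega> i *v r t $ p\<close> plus \<open>\<Omega> i *v (r t $ i - r t $ p)\<close>
      makes the main term depend on oscillator \<open>p\<close> only; the remainder vanishes by
      synchronization.\<close>
    let ?h = "\<lambda>t. \<Omega> i *v (r t $ i - r t $ p) + (coupling k A (r t) i - coupling k A (r t) p)"
    obtain C where C: "C-lipschitz_on {0..} (\<lambda>t. (\<Omega> i - \<Omega> p) *v r t $ p)"
      using lipschitz_on_matrix_vector_mult[OF L] by blast
    show ?thesis
    proof (rule barbalat_perturbed[OF _ sync[of i p] _ C])
      show "((\<lambda>t. r t $ i - r t $ p) has_vector_derivative (\<Omega> i - \<Omega> p) *v r t $ p + ?h t)
          (at t within {0..})" if "t \<ge> 0" for t
        using has_vector_derivative_diff[OF deriv[OF that, of i] deriv[OF that, of p]]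
        by (simp add: matrix_vector_mult_diff_rdistrib matrix_vector_mult_diff_distrib algebra_simps)
      have "(?h \<longlongrightarrow> \<Omega> i *v 0 + (0 - 0)) at_top"
        by (intro tendsto_intros tendsto_matrix_vector_mult sync coupling)
      then show "(?h \<longlongrightarrow> 0) at_top"
        by simp
    qed
  qed
  have all: "((\<lambda>t. ((\<Omega> i - \<Omega> p) ** matrix_power (\<Omega> p) l) *v r t $ p) \<longlongrightarrow> 0) at_top" for i l
    using deriv coupling L first by (rule annihilated_along_powers)

  \<comment> \<open>Sampling at integer times gives a sequence in the compact unit sphere; its limit
    point has norm 1 and so is nonzero.\<close>
  have "\<forall>n. r (real n) $ p \<in> sphere 0 1"
    using norm by simp
  then obtain \<xi> \<sigma> where \<xi>: "\<xi> \<in> sphere 0 1" "strict_mono (\<sigma> :: nat \<Rightarrow> nat)"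
      "((\<lambda>n. r (real n) $ p) \<circ> \<sigma>) \<longlonglongrightarrow> \<xi>"
    using compact_sphere[of "0 :: real^'n" 1] unfolding compact_def by metis
  have seq: "filterlim (\<lambda>n. real (\<sigma> n)) at_top sequentially"
    using filterlim_compose[OF filterlim_real_sequentially filterlim_subseq[OF \<xi>(2)]] .
  \<comment> \<open>The same sequence converges to this vector by continuity and to 0 by
    \<open>all\<close>; limits are unique.\<close>
  have "((\<Omega> i - \<Omega> p) ** matrix_power (\<Omega> p) l) *v \<xi> = 0" for i l
    using tendsto_matrix_vector_mult[OF \<xi>(3)] filterlim_compose[OF all seq]
    by (intro LIMSEQ_unique) (simp_all add: o_def)
  then have "matrix_power (\<Omega> i) l *v \<xi> = matrix_power (\<Omega> p) l *v \<xi>" for i l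
    by (rule matrix_power_agree)
  then have "matrix_power (\<Omega> i) l *v \<xi> = matrix_power (\<Omega> j) l *v \<xi>" for i j l
    by metis
  then have "\<xi> \<in> sync_space \<Omega>"
    unfolding sync_space_def by blast
  moreover have "\<xi> \<noteq> 0"
    using \<xi>(1) by auto
  ultimately show ?thesis
    unfolding dim_sync_space_pos_iff by blast
qed

end
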